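(* Let $\Bbbk$ be a field and let $A$ be a $2$-dimensional vector space over $\Bbbk$ with basis $x,y$, equipped with the comultiplication (linear map $\Delta\colon A\to A\otimes A$) given by $$\Delta x = x\otimes x,\qquad \Delta y = 0 .$$ Then each of the following bilinear multiplications on $A$ makes $A$ into a non-counital self-distributive bialgebra: (i) $x^2=0,\ xy=b_2y,\ yx=0,\ y^2=0$, where $b_2\in\Bbbk$; (ii) $x^2=x,\ xy=0,\ yx=c_2y,\ y^2=0$, where $c_2\in\Bbbk$.
   Context: Algebras are $\Bbbk$-vector spaces with a bilinear multiplication, not assumed associative or unital. A comultiplication on a vector space $A$ is a linear map $\Delta\colon A\to A\otimes A$; it is coassociative if $(\Delta\otimes\mathrm{id})\circ\Delta=(\mathrm{id}\otimes\Delta)\circ\Delta$. A counit for $(A,\Delta)$ is a linear map $\varepsilon\colon A\to\Bbbk$ with $(\varepsilon\otimes\mathrm{id})\circ\Delta=(\mathrm{id}\otimes\varepsilon)\circ\Delta=\mathrm{id}$ (identifying $\Bbbk\otimes A\cong A\cong A\otimes\Bbbk$). Non-counital means that no counit exists. A bialgebra is a vector space $A$ with a bilinear multiplication and a coassociative comultiplication $\Delta$ such that $\Delta(ab)=\Delta(a)\Delta(b)$ for all $a,b\in A$, where $A\otimes A$ has the component-wise product $(a\otimes b)(a'\otimes b')=aa'\otimes bb'$. In Sweedler notation $\Delta(c)=c^{(1)}\otimes c^{(2)}$ (summation understood), a bialgebra is self-distributive if $(ab)c=(ac^{(1)})(bc^{(2)})$ for all $a,b,c\in A$. *)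

theory Defs
  imports Complex_Main "HOL-Library.Function_Algebras"
begin

text \<open>
  A vector space is a type with an addition and a scalar multiplication \<open>s\<close> satisfying
  \<^locale>\<open>vector_space\<close>; the field itself is the vector space with scalar multiplication \<open>(*)\<close>.
\<close>

definition bilinear_map ::
  "('k::field \<Rightarrow> 'a::ab_group_add \<Rightarrow> 'a) \<Rightarrow> ('k \<Rightarrow> 'b::ab_group_add \<Rightarrow> 'b) \<Rightarrow>
   ('k \<Rightarrow> 'c::ab_group_add \<Rightarrow> 'c) \<Rightarrow> ('a \<Rightarrow> 'b \<Rightarrow> 'c) \<Rightarrow> bool"
  where "bilinear_map sA sB sC f \<longleftrightarrow>
    (\<forall>a. Vector_Spaces.linear sB sC (f a)) \<and> (\<forall>b. Vector_Spaces.linear sA sC (\<lambda>a. f a b))"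

definition trilinear_map ::
  "('k::field \<Rightarrow> 'a::ab_group_add \<Rightarrow> 'a) \<Rightarrow> ('k \<Rightarrow> 'b::ab_group_add \<Rightarrow> 'b) \<Rightarrow>
   ('k \<Rightarrow> 'c::ab_group_add \<Rightarrow> 'c) \<Rightarrow> ('k \<Rightarrow> 'd::ab_group_add \<Rightarrow> 'd) \<Rightarrow>
   ('a \<Rightarrow> 'b \<Rightarrow> 'c \<Rightarrow> 'd) \<Rightarrow> bool"
  where "trilinear_map sA sB sC sD f \<longleftrightarrow>
    (\<forall>a b. Vector_Spaces.linear sC sD (\<lambda>c. f a b c)) \<and>
    (\<forall>a c. Vector_Spaces.linear sB sD (\<lambda>b. f a b c)) \<and>
    (\<forall>b c. Vector_Spaces.linear sA sD (\<lambda>a. f a b c))"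


section \<open>Tensor products\<close>

text \<open>
  The tensor product of \<open>A\<close> and \<open>B\<close> is realised inside the space of functionals on bilinear forms
  on \<open>A \<times> B\<close>: the pure tensor of \<open>a\<close> and \<open>b\<close> is evaluation at \<open>(a, b)\<close>, and the tensor product is
  the span of the pure tensors. Functionals of pure tensors are set to \<open>0\<close> on arguments that are not
  bilinear, so that the ambient type carries no further information. The universal property is
  proved below (\<open>tensor_universal\<close>). Threefold tensors are the same construction with trilinear
  forms.
\<close>

type_synonym ('k, 'a, 'b) tensor = "('a \<Rightarrow> 'b \<Rightarrow> 'k) \<Rightarrow> 'k"
type_synonym ('k, 'a, 'b, 'c) tensor3 = "('a \<Rightarrow> 'b \<Rightarrow> 'c \<Rightarrow> 'k) \<Rightarrow> 'k"

definition fun_scale :: "'k::field \<Rightarrow> ('x \<Rightarrow> 'k) \<Rightarrow> ('x \<Rightarrow> 'k)"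
  where "fun_scale c t = (\<lambda>x. c * t x)"

definition pure_tensor ::
  "('k::field \<Rightarrow> 'a::ab_group_add \<Rightarrow> 'a) \<Rightarrow> ('k \<Rightarrow> 'b::ab_group_add \<Rightarrow> 'b) \<Rightarrow>
   'a \<Rightarrow> 'b \<Rightarrow> ('k, 'a, 'b) tensor"
  where "pure_tensor sA sB a b = (\<lambda>\<beta>. if bilinear_map sA sB (*) \<beta> then \<beta> a b else 0)"

definition tensor_space ::
  "('k::field \<Rightarrow> 'a::ab_group_add \<Rightarrow> 'a) \<Rightarrow> ('k \<Rightarrow> 'b::ab_group_add \<Rightarrow> 'b) \<Rightarrow>
   ('k, 'a, 'b) tensor set"
  where "tensor_space sA sB = module.span fun_scale {pure_tensor sA sB a b | a b. True}"

definition pure_tensor3 ::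
  "('k::field \<Rightarrow> 'a::ab_group_add \<Rightarrow> 'a) \<Rightarrow> ('k \<Rightarrow> 'b::ab_group_add \<Rightarrow> 'b) \<Rightarrow>
   ('k \<Rightarrow> 'c::ab_group_add \<Rightarrow> 'c) \<Rightarrow> 'a \<Rightarrow> 'b \<Rightarrow> 'c \<Rightarrow> ('k, 'a, 'b, 'c) tensor3"
  where "pure_tensor3 sA sB sC a b c =
    (\<lambda>\<gamma>. if trilinear_map sA sB sC (*) \<gamma> then \<gamma> a b c else 0)"

text \<open>
  The linear map on the tensor product induced by a bilinear map \<open>f\<close>. It sends a sum of pure
  tensors \<open>a\<^sub>i \<otimes> b\<^sub>i\<close> to the sum of the \<open>f a\<^sub>i b\<^sub>i\<close>; for bilinear \<open>f\<close> the value does not depend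
  on the decomposition (\<open>tensor_lift_sum_list\<close>). Scalars need not occur in a decomposition, as
  they can be absorbed into the factors.
\<close>

definition tensor_lift ::
  "('k::field \<Rightarrow> 'a::ab_group_add \<Rightarrow> 'a) \<Rightarrow> ('k \<Rightarrow> 'b::ab_group_add \<Rightarrow> 'b) \<Rightarrow>
   ('a \<Rightarrow> 'b \<Rightarrow> 'c::ab_group_add) \<Rightarrow> ('k, 'a, 'b) tensor \<Rightarrow> 'c"
  where "tensor_lift sA sB f t =
    (THE v. \<exists>ps. t = (\<Sum>(a, b)\<leftarrow>ps. pure_tensor sA sB a b) \<and> v = (\<Sum>(a, b)\<leftarrow>ps. f a b))"

text \<open>
  The canonical maps \<open>(A \<otimes> B) \<times> C \<rightarrow> A \<otimes> B \<otimes> C\<close> and \<open>A \<times> (B \<otimes> C) \<rightarrow> A \<otimes> B \<otimes> C\<close>, by which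
  \<open>(A \<otimes> B) \<otimes> C\<close> and \<open>A \<otimes> (B \<otimes> C)\<close> are identified with the threefold tensor product.
\<close>

definition tensor_append ::
  "('k::field \<Rightarrow> 'a::ab_group_add \<Rightarrow> 'a) \<Rightarrow> ('k \<Rightarrow> 'b::ab_group_add \<Rightarrow> 'b) \<Rightarrow>
   ('k \<Rightarrow> 'c::ab_group_add \<Rightarrow> 'c) \<Rightarrow> ('k, 'a, 'b) tensor \<Rightarrow> 'c \<Rightarrow> ('k, 'a, 'b, 'c) tensor3"
  where "tensor_append sA sB sC t c = tensor_lift sA sB (\<lambda>a b. pure_tensor3 sA sB sC a b c) t"

definition tensor_prepend ::
  "('k::field \<Rightarrow> 'a::ab_group_add \<Rightarrow> 'a) \<Rightarrow> ('k \<Rightarrow> 'b::ab_group_add \<Rightarrow> 'b) \<Rightarrow>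
   ('k \<Rightarrow> 'c::ab_group_add \<Rightarrow> 'c) \<Rightarrow> 'a \<Rightarrow> ('k, 'b, 'c) tensor \<Rightarrow> ('k, 'a, 'b, 'c) tensor3"
  where "tensor_prepend sA sB sC a t = tensor_lift sB sC (\<lambda>b c. pure_tensor3 sA sB sC a b c) t"

definition tensor_map ::
  "('k::field \<Rightarrow> 'a::ab_group_add \<Rightarrow> 'a) \<Rightarrow> ('k \<Rightarrow> 'b::ab_group_add \<Rightarrow> 'b) \<Rightarrow>
   ('k \<Rightarrow> 'c::ab_group_add \<Rightarrow> 'c) \<Rightarrow> ('k \<Rightarrow> 'd::ab_group_add \<Rightarrow> 'd) \<Rightarrow>
   ('a \<Rightarrow> 'c) \<Rightarrow> ('b \<Rightarrow> 'd) \<Rightarrow> ('k, 'a, 'b) tensor \<Rightarrow> ('k, 'c, 'd) tensor"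
  where "tensor_map sA sB sC sD f g =
    tensor_lift sA sB (\<lambda>a b. pure_tensor sC sD (f a) (g b))"


subsection \<open>The universal property\<close>

lemma vector_space_mult: "vector_space ((*) :: 'k::field \<Rightarrow> 'k \<Rightarrow> 'k)"
  by unfold_locales (auto simp: algebra_simps)

lemma vector_space_fun_scale: "vector_space (fun_scale :: 'k::field \<Rightarrow> ('x \<Rightarrow> 'k) \<Rightarrow> _)"
  by unfold_locales (auto simp: algebra_simps fun_scale_def fun_eq_iff)

lemma linear_functional_separates:
  fixes s :: "'k::field \<Rightarrow> 'a::ab_group_add \<Rightarrow> 'a"
  assumes "vector_space s" and "v \<noteq> 0"
  shows "\<exists>\<phi>. Vector_Spaces.linear s (*) \<phi> \<and> \<phi> v \<noteq> 0"
proof -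
  interpret vector_space_pair s "(*) :: 'k \<Rightarrow> 'k \<Rightarrow> 'k"
    using assms(1) vector_space_mult by (simp add: vector_space_pair_def)
  have "vs1.independent {v}"
    using assms(2) by (simp add: vs1.dependent_single)
  from linear_independent_extend[OF this, of "\<lambda>_. 1"] show ?thesis
    by auto
qed

lemma bilinear_map_comp_linear:
  assumes "bilinear_map sA sB sC f" and "Vector_Spaces.linear sC sD \<phi>"
  shows "bilinear_map sA sB sD (\<lambda>a b. \<phi> (f a b))"
  using assms Vector_Spaces.linear_compose[of sB sC _ sD \<phi>]
    Vector_Spaces.linear_compose[of sA sC _ sD \<phi>]
  unfolding bilinear_map_def o_def by blast

lemma bilinear_map_pure_tensor:
  assumes "vector_space sA" and "vector_space sB"
  shows "bilinear_map sA sB fun_scale (pure_tensor sA sB)"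
proof -
  have "pure_tensor sA sB (a + a') b = pure_tensor sA sB a b + pure_tensor sA sB a' b"
    "pure_tensor sA sB a (b + b') = pure_tensor sA sB a b + pure_tensor sA sB a b'"
    "pure_tensor sA sB (sA c a) b = fun_scale c (pure_tensor sA sB a b)"
    "pure_tensor sA sB a (sB c b) = fun_scale c (pure_tensor sA sB a b)" for a a' b b' c
    unfolding pure_tensor_def fun_eq_iff
    by (simp_all add: bilinear_map_def Vector_Spaces.linear_iff fun_scale_def)
  then show ?thesis
    unfolding bilinear_map_def Vector_Spaces.linear_iff
    using assms vector_space_fun_scale by blast
qed

lemma bilinear_map_scale_sum_list:
  assumes "bilinear_map sA sB sC f"
  shows "sC c (\<Sum>(a, b)\<leftarrow>ps. f a b) = (\<Sum>(a, b)\<leftarrow>map (\<lambda>(a, b). (sA c a, b)) ps. f a b)"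
proof -
  have *: "f (sA c a) b = sC c (f a b)" and "vector_space sC" for a b
    using assms unfolding bilinear_map_def Vector_Spaces.linear_iff by blast+
  then interpret C: vector_space sC by blast
  show ?thesis
  proof (induction ps)
    case Nil
    show ?case by (simp only: list.map sum_list.Nil C.scale_zero_right)
  next
    case (Cons p ps)
    then show ?case
      by (cases p) (simp only: list.map sum_list.Cons prod.case C.scale_right_distrib *)
  qed
qed

lemma sum_list_fun_apply:
  fixes F :: "'p \<Rightarrow> 'x \<Rightarrow> 'k::comm_monoid_add"
  shows "(\<Sum>p\<leftarrow>ps. F p) x = (\<Sum>p\<leftarrow>ps. F p x)"
  by (induction ps) auto

lemma linear_sum_list:
  assumes "Vector_Spaces.linear s s' \<phi>"
  shows "\<phi> (\<Sum>p\<leftarrow>ps. F p) = (\<Sum>p\<leftarrow>ps. \<phi> (F p))"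
proof -
  interpret Vector_Spaces.linear s s' \<phi> by fact
  show ?thesis by (induction ps) (auto simp: add zero)
qed

lemma tensor_lift_sum_list:
  fixes f :: "'a::ab_group_add \<Rightarrow> 'b::ab_group_add \<Rightarrow> 'c::ab_group_add"
    and sC :: "'k::field \<Rightarrow> 'c \<Rightarrow> 'c"
  assumes f: "bilinear_map sA sB sC f"
  shows "tensor_lift sA sB f (\<Sum>(a, b)\<leftarrow>ps. pure_tensor sA sB a b) = (\<Sum>(a, b)\<leftarrow>ps. f a b)"
proof -
  have vC: "vector_space sC"
    using f by (auto simp: bilinear_map_def Vector_Spaces.linear_iff)
  have uniq: "(\<Sum>(a, b)\<leftarrow>ps. f a b) = (\<Sum>(a, b)\<leftarrow>qs. f a b)"
    if eq: "(\<Sum>(a, b)\<leftarrow>ps. pure_tensor sA sB a b) = (\<Sum>(a, b)\<leftarrow>qs. pure_tensor sA sB a b)"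
    for ps qs
  proof (rule ccontr)
    assume "\<not> ?thesis"
    then have "(\<Sum>(a, b)\<leftarrow>ps. f a b) - (\<Sum>(a, b)\<leftarrow>qs. f a b) \<noteq> 0" by simp
    from linear_functional_separates[OF vC this] obtain \<phi>
      where \<phi>: "Vector_Spaces.linear sC (*) \<phi>"
        and ne: "\<phi> ((\<Sum>(a, b)\<leftarrow>ps. f a b) - (\<Sum>(a, b)\<leftarrow>qs. f a b)) \<noteq> 0" by blast
    interpret \<phi>: Vector_Spaces.linear sC "(*)" \<phi> by fact
    have bil: "bilinear_map sA sB (*) (\<lambda>a b. \<phi> (f a b))"
      by (rule bilinear_map_comp_linear[OF f \<phi>])
    have *: "\<phi> (\<Sum>(a, b)\<leftarrow>rs. f a b) =
        (\<Sum>(a, b)\<leftarrow>rs. pure_tensor sA sB a b) (\<lambda>a b. \<phi> (f a b))" for rs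
      using bil
      by (simp add: linear_sum_list[OF \<phi>] sum_list_fun_apply pure_tensor_def case_prod_unfold)
    show False using ne eq *[of ps] *[of qs] by (simp add: \<phi>.diff)
  qed
  show ?thesis
    unfolding tensor_lift_def
  proof (rule the_equality)
    show "\<exists>qs. (\<Sum>(a, b)\<leftarrow>ps. pure_tensor sA sB a b) = (\<Sum>(a, b)\<leftarrow>qs. pure_tensor sA sB a b) \<and>
        (\<Sum>(a, b)\<leftarrow>ps. f a b) = (\<Sum>(a, b)\<leftarrow>qs. f a b)"
      by (rule exI[of _ ps], rule conjI; rule refl)
  next
    fix v
    assume "\<exists>qs. (\<Sum>(a, b)\<leftarrow>ps. pure_tensor sA sB a b) =
        (\<Sum>(a, b)\<leftarrow>qs. pure_tensor sA sB a b) \<and> v = (\<Sum>(a, b)\<leftarrow>qs. f a b)"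
    then obtain qs where "(\<Sum>(a, b)\<leftarrow>ps. pure_tensor sA sB a b) =
        (\<Sum>(a, b)\<leftarrow>qs. pure_tensor sA sB a b)" and v: "v = (\<Sum>(a, b)\<leftarrow>qs. f a b)" by (elim exE conjE)
    from uniq[OF this(1)] show "v = (\<Sum>(a, b)\<leftarrow>ps. f a b)" unfolding v by (rule sym)
  qed
qed

lemma tensor_space_eq_sums:
  fixes sA :: "'k::field \<Rightarrow> 'a::ab_group_add \<Rightarrow> 'a"
    and sB :: "'k \<Rightarrow> 'b::ab_group_add \<Rightarrow> 'b"
  assumes "vector_space sA" and "vector_space sB"
  shows "tensor_space sA sB = {\<Sum>(a, b)\<leftarrow>ps. pure_tensor sA sB a b | ps. True}" (is "_ = ?S")
proof -
  interpret T: vector_space "fun_scale :: 'k \<Rightarrow> ('k, 'a, 'b) tensor \<Rightarrow> _"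
    by (rule vector_space_fun_scale)
  note scale = bilinear_map_scale_sum_list[OF bilinear_map_pure_tensor[OF assms]]
  have "T.subspace ?S"
  proof (rule T.subspaceI)
    show "0 \<in> ?S"
      by (rule CollectI, rule exI[of _ "[]"]) (simp only: list.map sum_list.Nil)
    show "t + u \<in> ?S" if "t \<in> ?S" "u \<in> ?S" for t u
    proof -
      from that obtain ps qs where "t = (\<Sum>(a, b)\<leftarrow>ps. pure_tensor sA sB a b)"
        "u = (\<Sum>(a, b)\<leftarrow>qs. pure_tensor sA sB a b)" by blast
      then show ?thesis
        by (intro CollectI exI[of _ "ps @ qs"]) (simp only: map_append sum_list_append simp_thms)
    qed
    show "fun_scale c t \<in> ?S" if "t \<in> ?S" for c t
      using that scale by blast
  qed
  moreover have "{pure_tensor sA sB a b | a b. True} \<subseteq> ?S"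
  proof -
    have "pure_tensor sA sB a b = (\<Sum>(a, b)\<leftarrow>[(a, b)]. pure_tensor sA sB a b)" for a b
      by (simp only: list.map sum_list.Cons sum_list.Nil prod.case add_0_right)
    then show ?thesis by blast
  qed
  ultimately have "T.span {pure_tensor sA sB a b | a b. True} \<subseteq> ?S"
    by (rule T.span_minimal[rotated])
  moreover have "(\<Sum>(a, b)\<leftarrow>ps. pure_tensor sA sB a b) \<in>
      T.span {pure_tensor sA sB a b | a b. True}" for ps
  proof (induction ps)
    case Nil
    show ?case by (simp only: list.map sum_list.Nil T.span_zero)
  next
    case (Cons p ps)
    obtain a b where p: "p = (a, b)" by force
    have "pure_tensor sA sB a b \<in> T.span {pure_tensor sA sB a b | a b. True}"
      by (rule T.span_base) blast
    from T.span_add[OF this Cons.IH] show ?case by (simp only: p list.map sum_list.Cons prod.case)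
  qed
  ultimately show ?thesis unfolding tensor_space_def by blast
qed

lemma tensor_universal:
  fixes f :: "'a::ab_group_add \<Rightarrow> 'b::ab_group_add \<Rightarrow> 'c::ab_group_add"
    and sC :: "'k::field \<Rightarrow> 'c \<Rightarrow> 'c"
  assumes f: "bilinear_map sA sB sC f"
  shows tensor_lift_pure: "tensor_lift sA sB f (pure_tensor sA sB a b) = f a b"
    and tensor_lift_add: "t \<in> tensor_space sA sB \<Longrightarrow> u \<in> tensor_space sA sB \<Longrightarrow>
          tensor_lift sA sB f (t + u) = tensor_lift sA sB f t + tensor_lift sA sB f u"
    and tensor_lift_scale: "t \<in> tensor_space sA sB \<Longrightarrow>
          tensor_lift sA sB f (fun_scale c t) = sC c (tensor_lift sA sB f t)"
    and tensor_lift_unique: "Vector_Spaces.linear fun_scale sC h \<Longrightarrow>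
          (\<And>a b. h (pure_tensor sA sB a b) = f a b) \<Longrightarrow> t \<in> tensor_space sA sB \<Longrightarrow>
          h t = tensor_lift sA sB f t"
proof -
  have v: "vector_space sA" "vector_space sB" "vector_space sC"
    using f by (auto simp: bilinear_map_def Vector_Spaces.linear_iff)
  note sums = tensor_space_eq_sums[OF v(1,2)]
  note lift = tensor_lift_sum_list[OF f]
  show "tensor_lift sA sB f (pure_tensor sA sB a b) = f a b"
    using lift[of "[(a, b)]"] by simp
  show "tensor_lift sA sB f (t + u) = tensor_lift sA sB f t + tensor_lift sA sB f u"
    if "t \<in> tensor_space sA sB" "u \<in> tensor_space sA sB"
  proof -
    from that obtain ps qs where "t = (\<Sum>(a, b)\<leftarrow>ps. pure_tensor sA sB a b)"
      "u = (\<Sum>(a, b)\<leftarrow>qs. pure_tensor sA sB a b)" unfolding sums by blast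
    then show ?thesis using lift[of "ps @ qs"] by (simp add: lift)
  qed
  show "tensor_lift sA sB f (fun_scale c t) = sC c (tensor_lift sA sB f t)"
    if "t \<in> tensor_space sA sB"
  proof -
    from that obtain ps where t: "t = (\<Sum>(a, b)\<leftarrow>ps. pure_tensor sA sB a b)"
      unfolding sums by blast
    have "fun_scale c t = (\<Sum>(a, b)\<leftarrow>map (\<lambda>(a, b). (sA c a, b)) ps. pure_tensor sA sB a b)"
      unfolding t by (rule bilinear_map_scale_sum_list[OF bilinear_map_pure_tensor[OF v(1,2)]])
    then have "tensor_lift sA sB f (fun_scale c t) =
        (\<Sum>(a, b)\<leftarrow>map (\<lambda>(a, b). (sA c a, b)) ps. f a b)"
      by (simp only: lift)
    also have "\<dots> = sC c (\<Sum>(a, b)\<leftarrow>ps. f a b)"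
      by (rule bilinear_map_scale_sum_list[OF f, symmetric])
    finally show ?thesis by (simp add: t lift)
  qed
  show "h t = tensor_lift sA sB f t"
    if "Vector_Spaces.linear fun_scale sC h" "\<And>a b. h (pure_tensor sA sB a b) = f a b"
      "t \<in> tensor_space sA sB" for h :: "('k, 'a, 'b) tensor \<Rightarrow> 'c"
  proof -
    from that(3) obtain ps where t: "t = (\<Sum>(a, b)\<leftarrow>ps. pure_tensor sA sB a b)"
      unfolding sums by blast
    show ?thesis
      unfolding t lift linear_sum_list[OF that(1)] by (simp add: that(2) case_prod_unfold)
  qed
qed


section \<open>Bialgebras\<close>

text \<open>
  Multiplications are not assumed associative or unital, and bialgebras are not assumed to be
  unital or counital.
\<close>

definition comultiplication ::
  "('k::field \<Rightarrow> 'a::ab_group_add \<Rightarrow> 'a) \<Rightarrow> ('a \<Rightarrow> ('k, 'a, 'a) tensor) \<Rightarrow> bool"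
  where "comultiplication s \<Delta> \<longleftrightarrow>
    Vector_Spaces.linear s fun_scale \<Delta> \<and> range \<Delta> \<subseteq> tensor_space s s"

definition comult_tensor_id ::
  "('k::field \<Rightarrow> 'a::ab_group_add \<Rightarrow> 'a) \<Rightarrow> ('a \<Rightarrow> ('k, 'a, 'a) tensor) \<Rightarrow>
   ('k, 'a, 'a) tensor \<Rightarrow> ('k, 'a, 'a, 'a) tensor3"
  where "comult_tensor_id s \<Delta> = tensor_lift s s (\<lambda>a b. tensor_append s s s (\<Delta> a) b)"

definition id_tensor_comult ::
  "('k::field \<Rightarrow> 'a::ab_group_add \<Rightarrow> 'a) \<Rightarrow> ('a \<Rightarrow> ('k, 'a, 'a) tensor) \<Rightarrow>
   ('k, 'a, 'a) tensor \<Rightarrow> ('k, 'a, 'a, 'a) tensor3"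
  where "id_tensor_comult s \<Delta> = tensor_lift s s (\<lambda>a b. tensor_prepend s s s a (\<Delta> b))"

definition coassociative ::
  "('k::field \<Rightarrow> 'a::ab_group_add \<Rightarrow> 'a) \<Rightarrow> ('a \<Rightarrow> ('k, 'a, 'a) tensor) \<Rightarrow> bool"
  where "coassociative s \<Delta> \<longleftrightarrow> comult_tensor_id s \<Delta> \<circ> \<Delta> = id_tensor_comult s \<Delta> \<circ> \<Delta>"

text \<open>
  The outer lifts in the next definition are the identifications of \<open>k \<otimes> A\<close> and \<open>A \<otimes> k\<close> with \<open>A\<close>.
\<close>

definition counit ::
  "('k::field \<Rightarrow> 'a::ab_group_add \<Rightarrow> 'a) \<Rightarrow> ('a \<Rightarrow> ('k, 'a, 'a) tensor) \<Rightarrow> ('a \<Rightarrow> 'k) \<Rightarrow> bool"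
  where "counit s \<Delta> \<epsilon> \<longleftrightarrow>
    Vector_Spaces.linear s (*) \<epsilon> \<and>
    tensor_lift (*) s s \<circ> tensor_map s s (*) s \<epsilon> id \<circ> \<Delta> = id \<and>
    tensor_lift s (*) (\<lambda>a c. s c a) \<circ> tensor_map s s s (*) id \<epsilon> \<circ> \<Delta> = id"

definition tensor_mult ::
  "('k::field \<Rightarrow> 'a::ab_group_add \<Rightarrow> 'a) \<Rightarrow> ('a \<Rightarrow> 'a \<Rightarrow> 'a) \<Rightarrow>
   ('k, 'a, 'a) tensor \<Rightarrow> ('k, 'a, 'a) tensor \<Rightarrow> ('k, 'a, 'a) tensor"
  where "tensor_mult s m t t' =
    tensor_lift s s (\<lambda>a b. tensor_lift s s (\<lambda>a' b'. pure_tensor s s (m a a') (m b b')) t') t"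

definition bialgebra ::
  "('k::field \<Rightarrow> 'a::ab_group_add \<Rightarrow> 'a) \<Rightarrow> ('a \<Rightarrow> 'a \<Rightarrow> 'a) \<Rightarrow>
   ('a \<Rightarrow> ('k, 'a, 'a) tensor) \<Rightarrow> bool"
  where "bialgebra s m \<Delta> \<longleftrightarrow>
    vector_space s \<and> bilinear_map s s s m \<and> comultiplication s \<Delta> \<and> coassociative s \<Delta> \<and>
    (\<forall>a b. \<Delta> (m a b) = tensor_mult s m (\<Delta> a) (\<Delta> b))"

definition self_distributive ::
  "('k::field \<Rightarrow> 'a::ab_group_add \<Rightarrow> 'a) \<Rightarrow> ('a \<Rightarrow> 'a \<Rightarrow> 'a) \<Rightarrow>
   ('a \<Rightarrow> ('k, 'a, 'a) tensor) \<Rightarrow> bool"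
  where "self_distributive s m \<Delta> \<longleftrightarrow>
    (\<forall>a b c. m (m a b) c = tensor_lift s s (\<lambda>c1 c2. m (m a c1) (m b c2)) (\<Delta> c))"

end

theory Submission
  imports Defs
begin

text \<open>
  Every \<open>a\<close> is \<open>p a \<cdot> x + q a \<cdot> y\<close> for two linear coordinate functionals, so the comultiplication is
  \<open>\<Delta> a = p a \<cdot> (x \<otimes> x)\<close>. For any comultiplication of this rank-one shape, \<open>\<Delta> a = \<chi> a \<cdot> (g \<otimes> g)\<close>
  with a linear functional \<open>\<chi>\<close>, the axioms become conditions without tensors: both sides of
  coassociativity are \<open>\<chi> a \<cdot> \<chi> g \<cdot> (g \<otimes> g \<otimes> g)\<close>; multiplicativity says
  \<open>\<chi> (a b) \<cdot> (g \<otimes> g) = \<chi> a \<cdot> \<chi> b \<cdot> (g g \<otimes> g g)\<close>; self-distributivity says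
  \<open>(a b) c = \<chi> c \<cdot> (a g) (b g)\<close>; and a counit forces \<open>\<chi>\<close> to be injective, because
  \<open>a = (\<epsilon> \<otimes> id) (\<Delta> a)\<close> vanishes whenever \<open>\<chi> a\<close> does.

  Here \<open>g = x\<close> and \<open>\<chi> = p\<close>, and \<open>p y = 0\<close> excludes counits. In family (i) the product is
  \<open>a b = b\<^sub>2 \<cdot> p a \<cdot> q b \<cdot> y\<close>, and in family (ii) it is \<open>a b = p b \<cdot> (p a \<cdot> x + c\<^sub>2 \<cdot> q a \<cdot> y)\<close>. In
  (i) both sides of the last two conditions vanish. In (ii), \<open>x x = x\<close> and \<open>p\<close> is multiplicative,
  which settles multiplicativity of \<open>\<Delta>\<close>; and right multiplication by any \<open>c\<close> is \<open>p c\<close> times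
  \<open>R = (\<lambda>a. a x)\<close>, a linear map with \<open>p \<circ> R = p\<close>, so both sides of self-distributivity are
  \<open>p c \<cdot> p b \<cdot> R (R a)\<close>.
\<close>

section \<open>Bilinear maps and lifts\<close>

lemma bilinear_mapI:
  assumes "vector_space sA" "vector_space sB" "vector_space sC"
    and "\<And>a a' b. f (a + a') b = f a b + f a' b"
    and "\<And>a b b'. f a (b + b') = f a b + f a b'"
    and "\<And>k a b. f (sA k a) b = sC k (f a b)"
    and "\<And>k a b. f a (sB k b) = sC k (f a b)"
  shows "bilinear_map sA sB sC f"
  using assms by (simp add: bilinear_map_def Vector_Spaces.linear_iff)

lemma bilinear_mapD:
  assumes "bilinear_map sA sB sC f"
  shows "f (a + a') b = f a b + f a' b"
    and "f a (b + b') = f a b + f a b'"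
    and "f (sA k a) b = sC k (f a b)"
    and "f a (sB k b) = sC k (f a b)"
  using assms by (auto simp: bilinear_map_def Vector_Spaces.linear_iff)

lemma pure_tensor3_multilinear:
  "pure_tensor3 sA sB sC (a + a') b c = pure_tensor3 sA sB sC a b c + pure_tensor3 sA sB sC a' b c"
  "pure_tensor3 sA sB sC a (b + b') c = pure_tensor3 sA sB sC a b c + pure_tensor3 sA sB sC a b' c"
  "pure_tensor3 sA sB sC a b (c + c') = pure_tensor3 sA sB sC a b c + pure_tensor3 sA sB sC a b c'"
  "pure_tensor3 sA sB sC (sA k a) b c = fun_scale k (pure_tensor3 sA sB sC a b c)"
  "pure_tensor3 sA sB sC a (sB k b) c = fun_scale k (pure_tensor3 sA sB sC a b c)"
  "pure_tensor3 sA sB sC a b (sC k c) = fun_scale k (pure_tensor3 sA sB sC a b c)"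
  unfolding pure_tensor3_def fun_eq_iff
  by (simp_all add: trilinear_map_def Vector_Spaces.linear_iff fun_scale_def)

lemma pure_tensor_in_tensor_space:
  "pure_tensor sA sB a b \<in> tensor_space sA sB"
proof -
  interpret T: vector_space fun_scale
    by (rule vector_space_fun_scale)
  show ?thesis
    unfolding tensor_space_def by (rule T.span_base) blast
qed

lemma tensor_lift_scaled_pure:
  assumes "bilinear_map sA sB sC f"
  shows "tensor_lift sA sB f (fun_scale k (pure_tensor sA sB a b)) = sC k (f a b)"
  by (simp add: tensor_lift_scale[OF assms pure_tensor_in_tensor_space] tensor_lift_pure[OF assms])

lemma tensor_lift_zero:
  assumes "bilinear_map sA sB sC f"
  shows "tensor_lift sA sB f 0 = 0"
  using tensor_lift_sum_list[OF assms, of "[]"] by simp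

section \<open>Rank-one comultiplications\<close>

locale rank_one_comultiplication =
  vector_space s for s :: "'k::field \<Rightarrow> 'a::ab_group_add \<Rightarrow> 'a" +
  fixes \<Delta> :: "'a \<Rightarrow> ('k, 'a, 'a) tensor" and \<chi> :: "'a \<Rightarrow> 'k" and g :: 'a
  assumes linear_weight: "Vector_Spaces.linear s (*) \<chi>"
    and comult_eq: "\<Delta> a = fun_scale (\<chi> a) (pure_tensor s s g g)"
begin

lemma vs: "vector_space s"
  by (rule vector_space_axioms)

lemma weight_add: "\<chi> (a + b) = \<chi> a + \<chi> b"
  and weight_scale: "\<chi> (s k a) = k * \<chi> a"
  using linear_weight by (auto simp: Vector_Spaces.linear_iff)

lemma lift_comult:
  assumes "bilinear_map s s sC f"
  shows "tensor_lift s s f (\<Delta> a) = sC (\<chi> a) (f g g)"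
  unfolding comult_eq by (rule tensor_lift_scaled_pure[OF assms])

lemma comultiplication: "comultiplication s \<Delta>"
proof -
  interpret T: vector_space "fun_scale :: 'k \<Rightarrow> ('k, 'a, 'a) tensor \<Rightarrow> _"
    by (rule vector_space_fun_scale)
  have "\<Delta> (a + b) = \<Delta> a + \<Delta> b" "\<Delta> (s k a) = fun_scale k (\<Delta> a)" for a b k
    unfolding comult_eq weight_add weight_scale
    by (simp_all only: T.scale_left_distrib T.scale_scale)
  moreover have "\<Delta> a \<in> tensor_space s s" for a
    unfolding comult_eq tensor_space_def
    by (rule T.span_scale, rule T.span_base) blast
  ultimately show ?thesis
    unfolding comultiplication_def Vector_Spaces.linear_iff
    using vs vector_space_fun_scale by blast
qed

lemma coassociative: "coassociative s \<Delta>"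
proof -
  note T3 = vector_space_fun_scale
  interpret T3: vector_space "fun_scale :: 'k \<Rightarrow> ('k, 'a, 'a, 'a) tensor3 \<Rightarrow> _"
    by (rule T3)
  have append: "tensor_append s s s (\<Delta> a) b = fun_scale (\<chi> a) (pure_tensor3 s s s g g b)" for a b
    unfolding tensor_append_def
    by (rule lift_comult, rule bilinear_mapI) (rule vs T3 pure_tensor3_multilinear)+
  have prepend: "tensor_prepend s s s a (\<Delta> b) = fun_scale (\<chi> b) (pure_tensor3 s s s a g g)" for a b
    unfolding tensor_prepend_def
    by (rule lift_comult, rule bilinear_mapI) (rule vs T3 pure_tensor3_multilinear)+
  have "bilinear_map s s fun_scale (\<lambda>a b. fun_scale (\<chi> a) (pure_tensor3 s s s g g b))"
    by (rule bilinear_mapI[OF vs vs T3])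
      (simp_all add: weight_add weight_scale pure_tensor3_multilinear
        T3.scale_left_distrib T3.scale_right_distrib mult.commute)
  then have left: "comult_tensor_id s \<Delta> (\<Delta> a) =
      fun_scale (\<chi> a) (fun_scale (\<chi> g) (pure_tensor3 s s s g g g))" for a
    unfolding comult_tensor_id_def append by (rule lift_comult)
  have "bilinear_map s s fun_scale (\<lambda>a b. fun_scale (\<chi> b) (pure_tensor3 s s s a g g))"
    by (rule bilinear_mapI[OF vs vs T3])
      (simp_all add: weight_add weight_scale pure_tensor3_multilinear
        T3.scale_left_distrib T3.scale_right_distrib mult.commute)
  then have "id_tensor_comult s \<Delta> (\<Delta> a) =
      fun_scale (\<chi> a) (fun_scale (\<chi> g) (pure_tensor3 s s s g g g))" for a
    unfolding id_tensor_comult_def prepend by (rule lift_comult)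
  with left show ?thesis
    unfolding coassociative_def by (simp add: fun_eq_iff)
qed

lemma tensor_mult_comult:
  assumes m: "bilinear_map s s s m"
  shows "tensor_mult s m (\<Delta> a) (\<Delta> b) =
    fun_scale (\<chi> a * \<chi> b) (pure_tensor s s (m g g) (m g g))"
proof -
  note T = vector_space_fun_scale
  interpret T: vector_space "fun_scale :: 'k \<Rightarrow> ('k, 'a, 'a) tensor \<Rightarrow> _"
    by (rule T)
  note bil = bilinear_mapD[OF m] bilinear_mapD[OF bilinear_map_pure_tensor[OF vs vs]]
  have inner: "tensor_lift s s (\<lambda>a' b'. pure_tensor s s (m c a') (m d b')) (\<Delta> b) =
      fun_scale (\<chi> b) (pure_tensor s s (m c g) (m d g))" for c d
    by (rule lift_comult, rule bilinear_mapI[OF vs vs T]) (simp_all only: bil)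
  have "bilinear_map s s fun_scale
      (\<lambda>c d. fun_scale (\<chi> b) (pure_tensor s s (m c g) (m d g)))"
    by (rule bilinear_mapI[OF vs vs T])
      (simp_all add: bil T.scale_right_distrib mult.commute)
  then show ?thesis
    unfolding tensor_mult_def inner by (simp add: lift_comult)
qed

lemma bialgebra_iff:
  assumes m: "bilinear_map s s s m"
  shows "bialgebra s m \<Delta> \<longleftrightarrow>
    (\<forall>a b. fun_scale (\<chi> (m a b)) (pure_tensor s s g g) =
      fun_scale (\<chi> a * \<chi> b) (pure_tensor s s (m g g) (m g g)))"
  unfolding bialgebra_def tensor_mult_comult[OF m]
  using vs m comultiplication coassociative by (simp add: comult_eq)

text \<open>
  If \<open>g\<close> spans a one-dimensional subalgebra, \<open>g g = e g\<close>, then \<open>g g \<otimes> g g = e\<^sup>2 (g \<otimes> g)\<close>, so an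
  idempotent \<open>e\<close> lets multiplicativity be checked on \<open>\<chi>\<close> alone.
\<close>

lemma bialgebra_if_idempotent:
  assumes m: "bilinear_map s s s m"
    and "m g g = s e g" and "e * e = e" and "\<And>a b. \<chi> (m a b) = e * \<chi> a * \<chi> b"
  shows "bialgebra s m \<Delta>"
proof -
  interpret T: vector_space "fun_scale :: 'k \<Rightarrow> ('k, 'a, 'a) tensor \<Rightarrow> _"
    by (rule vector_space_fun_scale)
  show ?thesis
    unfolding bialgebra_iff[OF m] assms(2,4)
    by (simp only: bilinear_mapD[OF bilinear_map_pure_tensor[OF vs vs]] T.scale_scale
        assms(3) mult_ac simp_thms)
qed

lemma self_distributive_iff:
  assumes m: "bilinear_map s s s m"
  shows "self_distributive s m \<Delta> \<longleftrightarrow>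
    (\<forall>a b c. m (m a b) c = s (\<chi> c) (m (m a g) (m b g)))"
proof -
  have "tensor_lift s s (\<lambda>c1 c2. m (m a c1) (m b c2)) (\<Delta> c) = s (\<chi> c) (m (m a g) (m b g))"
    for a b c
    by (rule lift_comult, rule bilinear_mapI[OF vs vs vs]) (simp_all only: bilinear_mapD[OF m])
  then show ?thesis
    unfolding self_distributive_def by simp
qed

lemma counit_weight_nonzero:
  assumes "counit s \<Delta> \<epsilon>" and "a \<noteq> 0"
  shows "\<chi> a \<noteq> 0"
proof
  assume "\<chi> a = 0"
  then have zero: "\<Delta> a = 0"
    by (simp add: comult_eq fun_scale_def fun_eq_iff)
  have \<epsilon>: "Vector_Spaces.linear s (*) \<epsilon>"
    using assms(1) by (simp add: counit_def)
  have "bilinear_map s s fun_scale (\<lambda>a b. pure_tensor (*) s (\<epsilon> a) (id b))"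
    using \<epsilon> by (intro bilinear_mapI vs vector_space_fun_scale)
      (simp_all add: Vector_Spaces.linear_iff
        bilinear_mapD[OF bilinear_map_pure_tensor[OF vector_space_mult vs]])
  then have map: "tensor_map s s (*) s \<epsilon> id 0 = 0"
    unfolding tensor_map_def by (rule tensor_lift_zero)
  have "bilinear_map (*) s s s"
    by (rule bilinear_mapI[OF vector_space_mult vs vs])
      (simp_all add: scale_left_distrib scale_right_distrib mult.commute)
  then have "tensor_lift (*) s s 0 = 0"
    by (rule tensor_lift_zero)
  moreover have "tensor_lift (*) s s (tensor_map s s (*) s \<epsilon> id (\<Delta> a)) = a"
    using assms(1) by (simp add: counit_def fun_eq_iff)
  ultimately show False
    using \<open>a \<noteq> 0\<close> by (simp add: zero map)
qed

end

section \<open>Coordinates in a plane\<close>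

lemma plane_coordinates:
  fixes s :: "'k::field \<Rightarrow> 'a::ab_group_add \<Rightarrow> 'a"
  assumes "vector_space s" and "x \<noteq> y"
    and indep: "\<not> module.dependent s {x, y}" and span: "module.span s {x, y} = UNIV"
  obtains p q where "Vector_Spaces.linear s (*) p" "p x = 1" "p y = 0" "q x = 0" "q y = 1"
    "\<And>a. a = s (p a) x + s (q a) y"
proof -
  interpret vector_space_pair s "(*) :: 'k \<Rightarrow> 'k \<Rightarrow> 'k"
    using assms(1) vector_space_mult by (simp add: vector_space_pair_def)
  obtain p where p: "Vector_Spaces.linear s (*) p" "p x = 1" "p y = 0"
    using linear_independent_extend[OF indep, of "\<lambda>v. if v = x then 1 else 0"] \<open>x \<noteq> y\<close> by auto
  obtain q where q: "Vector_Spaces.linear s (*) q" "q x = 0" "q y = 1"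
    using linear_independent_extend[OF indep, of "\<lambda>v. if v = y then 1 else 0"] \<open>x \<noteq> y\<close> by auto
  have "a = s (p a) x + s (q a) y" for a
  proof -
    have "a \<in> vs1.span {x, y}" using span by simp
    then obtain k l where a: "a = s k x + s l y"
      by (auto simp: vs1.span_insert vs1.span_singleton algebra_simps)
    have "p a = k" "q a = l"
      using p q unfolding a by (simp_all add: Vector_Spaces.linear_iff)
    with a show ?thesis by simp
  qed
  with p q show thesis using that by blast
qed

lemma bilinear_map_coordinates:
  fixes s :: "'k::field \<Rightarrow> 'a::ab_group_add \<Rightarrow> 'a"
  assumes m: "bilinear_map s s s m" and dec: "\<And>a. a = s (p a) x + s (q a) y"
  shows "m a b = s (p a * p b) (m x x) + s (p a * q b) (m x y)
    + s (q a * p b) (m y x) + s (q a * q b) (m y y)"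
proof -
  interpret vector_space s
    using m by (auto simp: bilinear_map_def Vector_Spaces.linear_iff)
  have "m a b = m (s (p a) x + s (q a) y) (s (p b) x + s (q b) y)"
    using dec[of a] dec[of b] by simp
  then show ?thesis
    by (simp add: bilinear_mapD[OF m] scale_right_distrib algebra_simps)
qed

section \<open>The two families of bialgebras\<close>

theorem proposition3p6:
  fixes s :: "'k::field \<Rightarrow> 'a::ab_group_add \<Rightarrow> 'a"
    and x y :: 'a
    and \<Delta> :: "'a \<Rightarrow> ('k, 'a, 'a) tensor"
  assumes "vector_space s"
    and "x \<noteq> y"
    and "\<not> module.dependent s {x, y}"
    and "module.span s {x, y} = UNIV"
    and "comultiplication s \<Delta>"
    and "\<Delta> x = pure_tensor s s x x"
    and "\<Delta> y = 0"
  shows "(\<forall>m b2. bilinear_map s s s m \<and>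
             m x x = 0 \<and> m x y = s b2 y \<and> m y x = 0 \<and> m y y = 0 \<longrightarrow>
           bialgebra s m \<Delta> \<and> self_distributive s m \<Delta> \<and> \<not> (\<exists>\<epsilon>. counit s \<Delta> \<epsilon>)) \<and>
         (\<forall>m c2. bilinear_map s s s m \<and>
             m x x = x \<and> m x y = 0 \<and> m y x = s c2 y \<and> m y y = 0 \<longrightarrow>
           bialgebra s m \<Delta> \<and> self_distributive s m \<Delta> \<and> \<not> (\<exists>\<epsilon>. counit s \<Delta> \<epsilon>))"
proof -
  obtain p q where p: "Vector_Spaces.linear s (*) p" and px: "p x = 1" and py: "p y = 0"
    and qx: "q x = 0" and dec: "\<And>a. a = s (p a) x + s (q a) y"
    using plane_coordinates[OF assms(1-4)] by blast
  interpret vector_space s by fact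
  interpret T: vector_space "fun_scale :: 'k \<Rightarrow> ('k, 'a, 'a) tensor \<Rightarrow> _"
    by (rule vector_space_fun_scale)
  have \<Delta>_lin: "\<Delta> (a + b) = \<Delta> a + \<Delta> b" "\<Delta> (s k a) = fun_scale k (\<Delta> a)" for a b k
    using assms(5) by (auto simp: comultiplication_def Vector_Spaces.linear_iff)
  have "\<Delta> a = fun_scale (p a) (pure_tensor s s x x)" for a
  proof -
    have "\<Delta> a = \<Delta> (s (p a) x + s (q a) y)" using dec[of a] by simp
    also have "\<dots> = fun_scale (p a) (pure_tensor s s x x)"
      by (simp only: \<Delta>_lin assms(6,7) T.scale_zero_right add_0_right)
    finally show ?thesis .
  qed
  then interpret rank_one_comultiplication s \<Delta> p x
    using p by (intro rank_one_comultiplication.intro rank_one_comultiplication_axioms.intro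
        vector_space_axioms)
  have p_simps: "p 0 = 0" "p (a + b) = p a + p b" "p (s k a) = k * p a" for a b k
    using weight_scale[of 0 0] weight_add weight_scale by simp_all
  have "y \<noteq> 0"
    using assms(3) dependent_zero[of "{x, y}"] by auto
  then have no_counit: "\<not> (\<exists>\<epsilon>. counit s \<Delta> \<epsilon>)"
    using counit_weight_nonzero py by blast
  have "bialgebra s m \<Delta> \<and> self_distributive s m \<Delta>"
    if m: "bilinear_map s s s m" "m x x = 0" "m x y = s b2 y" "m y x = 0" "m y y = 0" for m b2
  proof
    have prod: "m a b = s (p a * q b * b2) y" for a b
      using bilinear_map_coordinates[OF m(1) dec, of a b] m(2-) by simp
    show "bialgebra s m \<Delta>"
      by (rule bialgebra_if_idempotent[OF m(1), of 0]) (simp_all add: prod p_simps py qx)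
    show "self_distributive s m \<Delta>"
      unfolding self_distributive_iff[OF m(1)] by (simp add: prod p_simps py qx)
  qed
  moreover have "bialgebra s m \<Delta> \<and> self_distributive s m \<Delta>"
    if m: "bilinear_map s s s m" "m x x = x" "m x y = 0" "m y x = s c2 y" "m y y = 0" for m c2
  proof
    have prod: "m a b = s (p a * p b) x + s (q a * p b * c2) y" for a b
      using bilinear_map_coordinates[OF m(1) dec, of a b] m(2-) by simp
    have p_prod: "p (m a b) = p a * p b" for a b
      by (simp add: prod p_simps px py)
    show "bialgebra s m \<Delta>"
      by (rule bialgebra_if_idempotent[OF m(1), of 1]) (simp_all add: m(2) p_prod)
    \<comment> \<open>A right factor acts only through its \<open>p\<close>-coordinate, and \<open>b x\<close> has the same one as \<open>b\<close>.\<close>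
    have right: "m a b = s (p b) (m a x)" for a b
      by (simp add: prod px scale_right_distrib mult_ac)
    have "m (m a b) c = s (p c) (m (m a x) (m b x))" for a b c
    proof -
      have "m (m a b) c = s (p c) (m (m a b) x)" by (rule right)
      also have "m (m a b) x = s (p b) (m (m a x) x)"
        by (subst right) (simp only: bilinear_mapD[OF m(1)])
      also have "\<dots> = m (m a x) (m b x)"
        using right[of "m a x" "m b x"] by (simp add: p_prod px)
      finally show ?thesis .
    qed
    then show "self_distributive s m \<Delta>"
      unfolding self_distributive_iff[OF m(1)] by blast
  qed
  ultimately show ?thesis
    using no_counit by blast
qed

end
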